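(* For every fixed $0\le s\le 1$, there are arbitrarily large $n\in\mathbb N$ for which there exists a set $S\subseteq[n]^3$ with \[ |S|\ge n^{3-s} \] and \[ t(S)\ll n^{6-4s}. \]
   Context: $[n]$ denotes the set $\{1,\dots,n\}$ of the first $n$ positive integers, and $[n]^3\subset\mathbb R^3$ is the corresponding grid. For a finite set $S\subset\mathbb R^3$, $t(S)$ denotes the number of collinear triples in $S$, i.e. the number of three-element subsets of $S$ all of whose elements lie on a common line in $\mathbb R^3$. The notation $X\ll Y$ means $X\le CY$ for some absolute constant $C>0$. *)

theory Defs
  imports "HOL-Analysis.Analysis"
begin

definition grid :: "nat \<Rightarrow> (real ^ 3) set" where
  "grid n = {x. \<forall>i. x $ i \<in> real ` {1..n}}"

(* Meaningful for finite S only: card is 0 on infinite sets. *)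
definition collinear_triples :: "(real ^ 3) set \<Rightarrow> nat" where
  "collinear_triples S = card {T. T \<subseteq> S \<and> card T = 3 \<and> collinear T}"

end

theory Submission
  imports Defs "HOL-Number_Theory.Cong"
begin

text \<open>
  Let \<open>p\<close> be an odd prime, \<open>c\<close> a quadratic nonresidue modulo \<open>p\<close> and \<open>n = p k\<close>. The set is
  the periodic surface \<open>A = {(x, y, z) \<in> [n]\<^sup>3. z \<equiv> x\<^sup>2 - c y\<^sup>2 (mod p)}\<close>. It has
  \<open>n\<^sup>3 / p\<close> points (\<open>card_paraboloid_cube\<close>). Since the form \<open>x\<^sup>2 - c y\<^sup>2\<close> vanishes modulo \<open>p\<close>
  only at the origin (\<open>exists_anisotropic\<close>), the surface over the field with \<open>p\<close> elements
  contains no three points of a line (\<open>cap_mod_paraboloid\<close>). Along an integer line, \<open>A\<close>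
  therefore meets at most two residue classes of the parameter modulo \<open>p\<close>.

  This controls collinear triples in two ways. By the pigeonhole principle, two of the three
  points differ by \<open>p g d\<close> with \<open>d\<close> primitive and \<open>g \<noteq> 0\<close>, the third one differing by
  \<open>t d\<close>. If \<open>h\<close> is the maximum norm of \<open>d\<close>, then \<open>p |g| h \<le> n\<close> leaves at most \<open>2 k / h\<close>
  choices for \<open>g\<close> and forces \<open>h \<le> k\<close>; and \<open>t\<close>, lying in an interval of length
  \<open>2 n / h\<close> and in two classes modulo \<open>p\<close>, has \<open>O(k / h)\<close> choices. There are \<open>O(h\<^sup>2)\<close> vectors of
  norm \<open>h\<close>, so the sum of \<open>k\<^sup>2 / h\<^sup>2\<close> over all \<open>d\<close> of norm at most \<open>k\<close> is \<open>O(k\<^sup>3)\<close>. Hence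
  \<open>t(A) = O(k\<^sup>3 |A|) = O(n\<^sup>6 / p\<^sup>4)\<close> (\<open>collinear_triples_cap_mod\<close>).

  It remains to take \<open>p\<close> at most \<open>n\<^sup>s\<close> but of the same order: for \<open>s > 0\<close> a large prime \<open>p\<close>
  is given and \<open>k\<close> is about \<open>p\<close> to the power \<open>1/s - 1\<close>
  (\<open>exists_modulus_near_power\<close>). For \<open>s = 0\<close> one takes \<open>p = 1\<close>, that is, the whole grid; the
  same counting argument applies, all integers being congruent modulo 1.
\<close>

section \<open>Integer points\<close>

definition embed :: "int ^ 3 \<Rightarrow> real ^ 3" where
  "embed x = (\<chi> i. of_int (x $ i))"

definition cube :: "int \<Rightarrow> (int ^ 3) set" where
  "cube n = {x. \<forall>i. x $ i \<in> {1..n}}"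

definition height :: "int ^ 3 \<Rightarrow> int" where
  "height d = Max (range (\<lambda>i. \<bar>d $ i\<bar>))"

text \<open>
  Coprimality of the coordinates, in Bezout form: the coefficient vector \<open>a\<close> recovers the integer
  multiplier \<open>t\<close> from \<open>t *s d\<close>.
\<close>
definition primitive :: "int ^ 3 \<Rightarrow> bool" where
  "primitive d \<longleftrightarrow> (\<exists>a. (\<Sum>i\<in>UNIV. a $ i * d $ i) = 1)"

lemma inj_embed: "inj embed"
  by (auto simp: inj_def embed_def vec_eq_iff)

lemma embed_cube_subset_grid: "embed ` cube (int n) \<subseteq> grid n"
proof clarify
  fix x assume x: "x \<in> cube (int n)"
  have "\<exists>m\<in>{1..n}. real_of_int (x $ i) = real m" for i
  proof -
    have "x $ i \<in> {1..int n}" using x by (simp add: cube_def)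
    then show ?thesis by (intro bexI[of _ "nat (x $ i)"]) auto
  qed
  then show "embed x \<in> grid n"
    by (auto simp: grid_def embed_def image_iff)
qed

lemma height_le_iff: "height d \<le> m \<longleftrightarrow> (\<forall>i. \<bar>d $ i\<bar> \<le> m)"
  by (auto simp: height_def)

lemma abs_le_height: "\<bar>d $ i\<bar> \<le> height d"
  using height_le_iff by blast

lemma height_attained: "\<exists>i. height d = \<bar>d $ i\<bar>"
proof -
  have "height d \<in> range (\<lambda>i. \<bar>d $ i\<bar>)"
    unfolding height_def by (rule Max_in) auto
  then show ?thesis by blast
qed

lemma primitive_height_pos:
  assumes "primitive d"
  shows "height d \<ge> 1"
proof (rule ccontr)
  assume "\<not> ?thesis"
  then have "d $ i = 0" for i
    using abs_le_height[of d i] by simp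
  then show False
    using assms by (simp add: primitive_def)
qed

lemma primitive_not_dvd:
  assumes "primitive d" "\<And>i. p dvd d $ i"
  shows "p dvd 1"
proof -
  obtain a where "(\<Sum>i\<in>UNIV. a $ i * d $ i) = 1"
    using assms(1) by (auto simp: primitive_def)
  moreover have "p dvd (\<Sum>i\<in>UNIV. a $ i * d $ i)"
    using assms(2) by (intro dvd_sum dvd_mult)
  ultimately show ?thesis by simp
qed

lemma primitive_factorization:
  fixes e :: "int ^ 3"
  assumes "e \<noteq> 0"
  obtains d G where "primitive d" "G \<noteq> 0" "e = G *s d"
proof -
  define G where "G = gcd (e $ 1) (gcd (e $ 2) (e $ 3))"
  have G: "G \<noteq> 0"
    using assms by (auto simp: G_def vec_eq_iff forall_3)
  define d :: "int ^ 3" where "d = (\<chi> i. e $ i div G)"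
  have "G dvd e $ i" for i
    using exhaust_3[of i] by (auto simp: G_def intro: dvd_trans)
  then have e: "e = G *s d"
    by (simp add: vec_eq_iff d_def)
  obtain u v where uv: "u * e $ 2 + v * e $ 3 = gcd (e $ 2) (e $ 3)"
    using bezout_int by blast
  obtain x y where xy: "x * e $ 1 + y * gcd (e $ 2) (e $ 3) = G"
    using bezout_int unfolding G_def by blast
  have "x * e $ 1 + (y * u) * e $ 2 + (y * v) * e $ 3 = G"
    using xy uv by (metis (no_types, lifting) add.assoc distrib_left mult.assoc)
  then have "G * (x * d $ 1 + (y * u) * d $ 2 + (y * v) * d $ 3) = G * 1"
    unfolding e by (simp add: algebra_simps)
  then have "x * d $ 1 + (y * u) * d $ 2 + (y * v) * d $ 3 = 1"
    using G mult_left_cancel by blast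
  then have "primitive d"
    unfolding primitive_def
    by (intro exI[of _ "vector [x, y * u, y * v]"]) (simp add: sum_3)
  then show ?thesis using that G e by blast
qed

text \<open>
  The multiplier is the Bezout functional of \<open>d\<close> applied to \<open>f\<close>, hence an integer.
\<close>
lemma parallel_primitive:
  assumes "primitive d" "\<And>i j. d $ i * f $ j = d $ j * f $ i"
  obtains t where "f = t *s d"
proof -
  obtain a where a: "(\<Sum>i\<in>UNIV. a $ i * d $ i) = 1"
    using assms by (auto simp: primitive_def)
  have "f $ j = (\<Sum>i\<in>UNIV. a $ i * f $ i) * d $ j" for j
  proof -
    have "(\<Sum>i\<in>UNIV. a $ i * f $ i) * d $ j = (\<Sum>i\<in>UNIV. a $ i * (d $ j * f $ i))"
      unfolding sum_distrib_right by (intro sum.cong) simp_all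
    also have "\<dots> = (\<Sum>i\<in>UNIV. a $ i * (d $ i * f $ j))"
      by (intro sum.cong refl arg_cong[of _ _ "(*) _"] assms(2)[symmetric])
    also have "\<dots> = (\<Sum>i\<in>UNIV. a $ i * d $ i) * f $ j"
      unfolding sum_distrib_right by (intro sum.cong) simp_all
    finally show ?thesis using a by simp
  qed
  then show ?thesis
    using that[of "\<Sum>i\<in>UNIV. a $ i * f $ i"] by (metis (no_types) vec_eq_iff vector_smult_component)
qed

text \<open>
  Real collinearity becomes integral: the integer points of a line form one arithmetic progression
  whose step is primitive.
\<close>
lemma collinear_integer_points:
  assumes "collinear {embed u, embed v, embed w}" "u \<noteq> v"
  obtains d G t where "primitive d" "G \<noteq> 0" "v = u + G *s d" "w = u + t *s d"
proof -
  have "v - u \<noteq> 0" using assms by simp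
  then obtain d G where d: "primitive d" "G \<noteq> 0" "v - u = G *s d"
    using primitive_factorization by blast
  have "collinear {0, embed v - embed u, embed w - embed u}"
    using assms(1) collinear_3[of "embed v" "embed u" "embed w"]
    by (simp add: insert_commute)
  moreover have "embed v - embed u \<noteq> 0"
    using assms(2) inj_embed by (auto dest: injD)
  ultimately obtain c where c: "embed w - embed u = c *\<^sub>R (embed v - embed u)"
    unfolding collinear_lemma by (metis scaleR_zero_left)
  have "d $ i * (w - u) $ j = d $ j * (w - u) $ i" for i j
  proof -
    have *: "real_of_int ((w - u) $ l) = c * (G * d $ l)" for l
    proof -
      have "real_of_int ((w - u) $ l) = c * ((v - u) $ l)"
        using c by (simp add: vec_eq_iff embed_def)
      then show ?thesis by (simp only: d(3) vector_smult_component)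
    qed
    have "real_of_int (d $ i * (w - u) $ j) = real_of_int (d $ j * (w - u) $ i)"
      by (simp only: of_int_mult * ) simp
    then show ?thesis by (simp only: of_int_eq_iff)
  qed
  then obtain t where "w - u = t *s d"
    using parallel_primitive[OF d(1)] by blast
  then show ?thesis
    using that[OF d(1,2)] d(3) by (metis add.commute diff_add_cancel)
qed

section \<open>Counting directions and multiples\<close>

text \<open>
  Some coordinate equals \<open>\<plusminus> m\<close> and the other two lie in \<open>{-m..m}\<close>; the constant is
  \<open>3 * 2 * 3\<^sup>2\<close>.
\<close>
lemma card_shell:
  assumes "m \<ge> 1"
  shows "finite {d. height d = int m}" "card {d. height d = int m} \<le> 54 * m\<^sup>2"
proof -
  define X Y where "X = {- int m, int m}" and "Y = {- int m..int m}"
  define B where "B = X \<times> Y \<times> Y \<union> Y \<times> X \<times> Y \<union> Y \<times> Y \<times> X"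
  define f :: "int \<times> int \<times> int \<Rightarrow> int ^ 3" where "f = (\<lambda>(x, y, z). vector [x, y, z])"
  have fin: "finite B" by (auto simp: B_def X_def Y_def)
  have sub: "{d. height d = int m} \<subseteq> f ` B"
  proof clarify
    fix d assume d: "height d = int m"
    then obtain i where i: "\<bar>d $ i\<bar> = int m" using height_attained by metis
    have Y: "d $ j \<in> Y" for j
      using abs_le_height[of d j] d by (auto simp: Y_def)
    have "d $ i \<in> X" using i by (auto simp: X_def)
    then have "(d $ 1, d $ 2, d $ 3) \<in> B"
      using Y exhaust_3[of i] by (auto simp: B_def)
    moreover have "d = f (d $ 1, d $ 2, d $ 3)"
      by (simp add: f_def vec_eq_iff forall_3)
    ultimately show "d \<in> f ` B" by blast
  qed
  show "finite {d. height d = int m}"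
    using sub fin finite_surj by blast
  have XY: "card X = 2" "card Y = 2 * m + 1"
    using assms by (auto simp: X_def Y_def)
  have "card {d. height d = int m} \<le> card B"
    using sub fin surj_card_le by blast
  also have "card B \<le> card (X \<times> Y \<times> Y) + card (Y \<times> X \<times> Y) + card (Y \<times> Y \<times> X)"
    unfolding B_def using card_Un_le by (metis (no_types, lifting) add_le_mono1 le_trans)
  also have "\<dots> = 6 * (2 * m + 1)\<^sup>2"
    by (simp add: card_cartesian_product XY power2_eq_square)
  also have "\<dots> \<le> 6 * (3 * m)\<^sup>2"
    using assms by (intro mult_left_mono power_mono) auto
  finally show "card {d. height d = int m} \<le> 54 * m\<^sup>2"
    by (simp add: power_mult_distrib)
qed

text \<open>
  Each shell contributes a bounded amount because its size is quadratic in the height. This linear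
  growth in \<open>k\<close> is where dimension three matters.
\<close>
lemma sum_inverse_square_height:
  "finite {d. 1 \<le> height d \<and> height d \<le> int k}"
  "(\<Sum>d | 1 \<le> height d \<and> height d \<le> int k. 1 / (real_of_int (height d))\<^sup>2) \<le> 54 * k"
proof -
  let ?H = "\<lambda>m. {d. height d = int m}"
  have eq: "{d. 1 \<le> height d \<and> height d \<le> int k} = (\<Union>m\<in>{1..k}. ?H m)" (is "?D = _")
  proof (intro equalityI subsetI)
    fix d assume "d \<in> ?D"
    then show "d \<in> (\<Union>m\<in>{1..k}. ?H m)"
      by (intro UN_I[of "nat (height d)"]) auto
  qed auto
  show "finite ?D"
    unfolding eq using card_shell by auto
  have "(\<Sum>d\<in>?D. 1 / (real_of_int (height d))\<^sup>2)
      = (\<Sum>m\<in>{1..k}. \<Sum>d\<in>?H m. 1 / (real_of_int (height d))\<^sup>2)"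
    unfolding eq by (rule sum.UNION_disjoint) (use card_shell in auto)
  also have "\<dots> \<le> (\<Sum>m\<in>{1..k}. 54)"
  proof (rule sum_mono)
    fix m assume m: "m \<in> {1..k}"
    have "real (card (?H m)) \<le> real (54 * m\<^sup>2)"
      using m card_shell[of m] by (simp only: of_nat_le_iff) auto
    then show "(\<Sum>d\<in>?H m. 1 / (real_of_int (height d))\<^sup>2) \<le> 54"
      using m by (simp add: field_simps)
  qed
  finally show "(\<Sum>d\<in>?D. 1 / (real_of_int (height d))\<^sup>2) \<le> 54 * k" by simp
qed

lemma card_residue_class:
  fixes p L r :: int
  assumes "p \<ge> 1" "L \<ge> 0"
  shows "card {t \<in> {-L..L}. t mod p = r} \<le> nat (2 * (L div p) + 2)"
proof -
  let ?F = "{t \<in> {-L..L}. t mod p = r}"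
  have "inj_on (\<lambda>t. t div p) ?F"
    by (rule inj_onI) (metis (mono_tags, lifting) mem_Collect_eq mult_div_mod_eq)
  moreover have "(\<lambda>t. t div p) ` ?F \<subseteq> {- (L div p) - 1..L div p}"
  proof clarsimp
    fix t assume t: "- L \<le> t" "t \<le> L"
    have "(-L) div p \<ge> - (L div p) - 1"
      using assms by (simp add: zdiv_zminus1_eq_if)
    moreover have "(-L) div p \<le> t div p" "t div p \<le> L div p"
      using t assms by (auto intro: zdiv_mono1)
    ultimately show "- (L div p) - 1 \<le> t div p \<and> t div p \<le> L div p" by simp
  qed
  ultimately have "card ?F \<le> card {- (L div p) - 1..L div p}"
    using card_inj_on_le by blast
  then show ?thesis by (simp add: algebra_simps)
qed

lemma card_two_residue_classes:
  fixes p L :: int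
  assumes "p \<ge> 1" "L \<ge> 0" "T \<subseteq> {-L..L}"
    and two: "\<And>x y z. \<lbrakk>x \<in> T; y \<in> T; z \<in> T\<rbrakk> \<Longrightarrow> p dvd x - y \<or> p dvd x - z \<or> p dvd y - z"
  shows "card T \<le> 2 * nat (2 * (L div p) + 2)"
proof -
  let ?F = "\<lambda>r. {t \<in> {-L..L}. t mod p = r}"
  have "\<exists>r r'. T \<subseteq> ?F r \<union> ?F r'"
  proof (cases "\<exists>x\<in>T. \<exists>y\<in>T. \<not> p dvd x - y")
    case True
    then obtain x y where xy: "x \<in> T" "y \<in> T" "\<not> p dvd x - y" by blast
    have "T \<subseteq> ?F (x mod p) \<union> ?F (y mod p)"
    proof
      fix z assume z: "z \<in> T"
      then have "p dvd x - z \<or> p dvd y - z" using two xy by blast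
      then show "z \<in> ?F (x mod p) \<union> ?F (y mod p)"
        using z assms(3) by (auto simp: mod_eq_dvd_iff dvd_diff_commute)
    qed
    then show ?thesis by blast
  next
    case False
    show ?thesis
    proof (cases "T = {}")
      case False
      then obtain x where "x \<in> T" by blast
      then have "T \<subseteq> ?F (x mod p)"
        using \<open>\<not> (\<exists>x\<in>T. _ x)\<close> assms(3) by (auto simp: mod_eq_dvd_iff)
      then show ?thesis by blast
    qed simp
  qed
  then obtain r r' where "T \<subseteq> ?F r \<union> ?F r'" by blast
  moreover have "finite (?F r \<union> ?F r')" by (rule finite_subset[of _ "{-L..L}"]) auto
  ultimately have "card T \<le> card (?F r \<union> ?F r')" by (intro card_mono)
  also have "\<dots> \<le> card (?F r) + card (?F r')" by (rule card_Un_le)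
  also have "\<dots> \<le> 2 * nat (2 * (L div p) + 2)"
    using card_residue_class[OF assms(1,2), of r] card_residue_class[OF assms(1,2), of r'] by linarith
  finally show ?thesis .
qed

section \<open>Collinear triples in a cap modulo p\<close>

text \<open>
  The analogue of a cap in finite geometry (a set without three collinear points), for sets of
  integer points reduced modulo \<open>p\<close>. Since the line parameters are compared rather than the
  points, the notion is meaningful for \<open>p = 1\<close>, where every set satisfies it.
\<close>
definition cap_mod :: "int \<Rightarrow> (int ^ 3) set \<Rightarrow> bool" where
  "cap_mod p A \<longleftrightarrow> (\<forall>u d x y z. primitive d \<longrightarrow>
     u + x *s d \<in> A \<longrightarrow> u + y *s d \<in> A \<longrightarrow> u + z *s d \<in> A \<longrightarrow>
     p dvd x - y \<or> p dvd x - z \<or> p dvd y - z)"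

text \<open>
  Among the parameters \<open>0\<close>, \<open>G\<close>, \<open>t\<close> of the three points two are congruent modulo \<open>p\<close>; one of
  these two points is chosen as the base point \<open>b\<close>.
\<close>
lemma cap_mod_collinear_triple:
  assumes cap: "cap_mod p A"
    and A: "u \<in> A" "v \<in> A" "w \<in> A" and ne: "u \<noteq> v" "u \<noteq> w" "v \<noteq> w"
    and col: "collinear {embed u, embed v, embed w}"
  obtains b d g t where "b \<in> A" "primitive d" "g \<noteq> 0"
    "b + (p * g) *s d \<in> A" "b + t *s d \<in> A" "{u, v, w} = {b, b + (p * g) *s d, b + t *s d}"
proof -
  obtain d G t where d: "primitive d" "G \<noteq> 0" "v = u + G *s d" "w = u + t *s d"
    using collinear_integer_points[OF col ne(1)] by blast
  have "u + 0 *s d \<in> A" using A by simp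
  then consider "p dvd 0 - G" | "p dvd 0 - t" | "p dvd G - t"
    using cap d A unfolding cap_mod_def by metis
  then show ?thesis
  proof cases
    case 1
    then obtain g where "G = p * g" by (auto elim: dvdE)
    then show ?thesis using that[of u d g t] d A by auto
  next
    case 2
    then obtain g where g: "t = p * g" by (auto elim: dvdE)
    moreover have "g \<noteq> 0" using g d ne by auto
    ultimately show ?thesis using that[of u d g G] d A by (auto simp: insert_commute)
  next
    case 3
    then have "p dvd t - G" by (simp add: dvd_diff_commute)
    then obtain g where g: "t - G = p * g" by (auto elim: dvdE)
    have w: "w = v + (p * g) *s d"
      using d g by (simp add: vec_eq_iff flip: g)
    have u: "u = v + (- G) *s d"
      using d by (simp add: vec_eq_iff)
    have "g \<noteq> 0" using w ne by auto
    then show ?thesis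
      using that[of v d g "- G"] d(1) A u w by (metis insert_commute)
  qed
qed

lemma cube_chord:
  assumes "b \<in> cube n" "b + t *s d \<in> cube n"
  shows "\<bar>t\<bar> * height d \<le> n"
proof -
  obtain i where i: "height d = \<bar>d $ i\<bar>" using height_attained by blast
  have "1 \<le> b $ i" "b $ i \<le> n" "1 \<le> b $ i + t * d $ i" "b $ i + t * d $ i \<le> n"
    using assms by (auto simp: cube_def dest: spec[of _ i])
  then have "\<bar>t * d $ i\<bar> \<le> n" by linarith
  then show ?thesis by (simp add: i abs_mult)
qed

lemma finite_cube: "finite (cube n)"
proof (rule finite_subset)
  show "cube n \<subseteq> (\<lambda>(x, y, z). vector [x, y, z]) ` ({1..n} \<times> {1..n} \<times> {1..n})"
  proof
    fix x assume "x \<in> cube n"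
    moreover have "x = vector [x $ 1, x $ 2, x $ 3]" by (simp add: vec_eq_iff forall_3)
    ultimately show "x \<in> (\<lambda>(x, y, z). vector [x, y, z]) ` ({1..n} \<times> {1..n} \<times> {1..n})"
      by (intro image_eqI[of _ _ "(x $ 1, x $ 2, x $ 3)"]) (auto simp: cube_def)
  qed
qed auto

lemma card_nonzero_bounded_multiples:
  fixes h k :: int
  assumes "1 \<le> h" "0 \<le> k"
  shows "finite {g. g \<noteq> 0 \<and> \<bar>g\<bar> * h \<le> k}"
    "real (card {g. g \<noteq> 0 \<and> \<bar>g\<bar> * h \<le> k}) \<le> 2 * (k / h)"
proof -
  let ?q = "k div h"
  have q: "?q \<ge> 0" using assms by (simp add: pos_imp_zdiv_nonneg_iff)
  have sub: "{g. g \<noteq> 0 \<and> \<bar>g\<bar> * h \<le> k} \<subseteq> {- ?q..?q} - {0}"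
  proof clarsimp
    fix g assume "\<bar>g\<bar> * h \<le> k"
    then have "(\<bar>g\<bar> * h) div h \<le> ?q" using assms by (intro zdiv_mono1) auto
    then have "\<bar>g\<bar> \<le> ?q" using assms by simp
    then show "- ?q \<le> g \<and> g \<le> ?q" by linarith
  qed
  then show "finite {g. g \<noteq> 0 \<and> \<bar>g\<bar> * h \<le> k}" by (rule finite_subset) auto
  have "card {g. g \<noteq> 0 \<and> \<bar>g\<bar> * h \<le> k} \<le> card ({- ?q..?q} - {0})"
    using sub by (intro card_mono) auto
  also have "\<dots> = nat (2 * ?q)"
    using q by (subst card_Diff_singleton) auto
  finally have "real (card {g. g \<noteq> 0 \<and> \<bar>g\<bar> * h \<le> k}) \<le> 2 * real_of_int ?q"
    using q by linarith
  also have "real_of_int ?q \<le> k / h" by (rule real_of_int_div4)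
  finally show "real (card {g. g \<noteq> 0 \<and> \<bar>g\<bar> * h \<le> k}) \<le> 2 * (k / h)" by simp
qed

text \<open>
  The parameters satisfy \<open>|t| \<le> p k / h\<close> for the height \<open>h\<close> of \<open>d\<close> and lie in two residue
  classes, each with at most \<open>2 k / h + 2\<close> members. The assumption \<open>h \<le> k\<close> absorbs the
  additive constant.
\<close>
lemma card_cap_mod_line:
  fixes b :: "int ^ 3"
  assumes p: "p \<ge> 1" and cap: "cap_mod p A" and d: "primitive d" "height d \<le> int k"
  defines "T \<equiv> {t. \<bar>t\<bar> * height d \<le> p * int k \<and> b + t *s d \<in> A}"
  shows "finite T" "real (card T) \<le> 8 * (k / height d)"
proof -
  define h where "h = height d"
  have h: "h \<ge> 1" "h \<le> int k" using d primitive_height_pos by (auto simp: h_def)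
  define L where "L = p * int k div h"
  have L0: "L \<ge> 0" using h p by (simp add: L_def pos_imp_zdiv_nonneg_iff)
  have sub: "T \<subseteq> {-L..L}"
  proof
    fix t assume "t \<in> T"
    then have "\<bar>t\<bar> * h \<le> p * int k" by (simp add: T_def h_def)
    then have "(\<bar>t\<bar> * h) div h \<le> L" unfolding L_def using h by (intro zdiv_mono1) auto
    then show "t \<in> {-L..L}" using h by auto
  qed
  then show "finite T" by (rule finite_subset) auto
  have "card T \<le> 2 * nat (2 * (L div p) + 2)"
  proof (rule card_two_residue_classes[OF p L0 sub])
    fix x y z assume "x \<in> T" "y \<in> T" "z \<in> T"
    then show "p dvd x - y \<or> p dvd x - z \<or> p dvd y - z"
      using cap d(1) unfolding cap_mod_def T_def by blast
  qed
  moreover have "L div p \<ge> 0" using L0 p by (simp add: pos_imp_zdiv_nonneg_iff)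
  ultimately have "real (card T) \<le> 4 * real_of_int (L div p) + 4" by linarith
  also have "real_of_int (L div p) \<le> L / p" by (rule real_of_int_div4)
  also have "\<dots> \<le> (p * int k / h) / p"
    unfolding L_def using p by (intro divide_right_mono real_of_int_div4) auto
  also have "\<dots> = k / h" using p by simp
  also have "4 * (k / h) + 4 \<le> 8 * (k / h)"
  proof -
    have "k / h \<ge> 1" using h by (simp add: le_divide_eq)
    then show ?thesis by simp
  qed
  finally show "real (card T) \<le> 8 * (k / height d)" by (simp add: h_def)
qed

text \<open>
  Every collinear triple comes from some data \<open>(b, d, g, t)\<close> as in \<open>cap_mod_collinear_triple\<close>, so
  it suffices to count these data. The constant is \<open>2 * 8 * 54\<close>, from the bounds for \<open>g\<close>,
  \<open>t\<close> and \<open>d\<close>.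
\<close>
theorem collinear_triples_cap_mod:
  assumes p: "p \<ge> 1" and A: "A \<subseteq> cube (p * int k)" and cap: "cap_mod p A"
  shows "real (collinear_triples (embed ` A)) \<le> 864 * real k ^ 3 * real (card A)"
proof -
  have finA: "finite A" using A finite_cube finite_subset by blast
  define D where "D = {d. primitive d \<and> height d \<le> int k}"
  define G where "G d = {g. g \<noteq> 0 \<and> \<bar>g\<bar> * height d \<le> int k}" for d
  define T where "T b d = {t. \<bar>t\<bar> * height d \<le> p * int k \<and> b + t *s d \<in> A}" for b d
  define W where "W = (SIGMA b:A. SIGMA d:D. G d \<times> T b d)"
  define F where "F = (\<lambda>(b, d, g, t). embed ` {b, b + (p * g) *s d, b + t *s d})"
  have D: "D \<subseteq> {d. 1 \<le> height d \<and> height d \<le> int k}"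
    using primitive_height_pos by (auto simp: D_def)
  have finD: "finite D"
    using D sum_inverse_square_height(1) by (rule finite_subset)
  have finG: "finite (G d)" "real (card (G d)) \<le> 2 * (k / height d)" if "d \<in> D" for d
    using card_nonzero_bounded_multiples[of "height d" "int k"] that D by (auto simp: G_def)
  have finT: "finite (T b d)" "real (card (T b d)) \<le> 8 * (k / height d)" if "d \<in> D" for b d
    using card_cap_mod_line[OF p cap, of d k b] that by (auto simp: D_def T_def)
  have finW: "finite W"
    unfolding W_def using finA finD finG finT by (intro finite_SigmaI finite_cartesian_product) auto
  have cover: "{X. X \<subseteq> embed ` A \<and> card X = 3 \<and> collinear X} \<subseteq> F ` W"
  proof clarify
    fix X assume X: "X \<subseteq> embed ` A" "card X = 3" "collinear X"
    then obtain Y where Y: "Y \<subseteq> A" "X = embed ` Y" by (meson subset_imageE)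
    then have "card Y = 3"
      using X(2) by (metis card_image inj_embed inj_on_subset subset_UNIV)
    then obtain u v w where uvw: "Y = {u, v, w}" "u \<noteq> v" "u \<noteq> w" "v \<noteq> w"
      by (auto simp: card_3_iff)
    then have col: "collinear {embed u, embed v, embed w}" using X(3) Y by simp
    have "u \<in> A" "v \<in> A" "w \<in> A" using uvw Y by auto
    then obtain b d g t where *: "b \<in> A" "primitive d" "g \<noteq> 0"
      "b + (p * g) *s d \<in> A" "b + t *s d \<in> A" "{u, v, w} = {b, b + (p * g) *s d, b + t *s d}"
      by (rule cap_mod_collinear_triple[OF cap _ _ _ uvw(2-4) col])
    have "\<bar>p * g\<bar> * height d \<le> p * int k" and t: "\<bar>t\<bar> * height d \<le> p * int k"
      using * A by (blast intro: cube_chord)+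
    then have "p * (\<bar>g\<bar> * height d) \<le> p * int k"
      using p by (simp add: abs_mult mult.assoc)
    then have g: "\<bar>g\<bar> * height d \<le> int k"
      using p by simp
    \<comment> \<open>As \<open>g\<close> is nonzero, a difference divisible by \<open>p\<close> forces the direction to be short.\<close>
    moreover have "1 * height d \<le> \<bar>g\<bar> * height d"
      using *(2,3) primitive_height_pos[of d] by (intro mult_right_mono) auto
    ultimately have "(b, d, g, t) \<in> W"
      using * t by (auto simp: W_def D_def G_def T_def)
    moreover have "X = F (b, d, g, t)" using Y uvw(1) *(6) by (simp add: F_def)
    ultimately show "X \<in> F ` W" by blast
  qed
  then have "real (collinear_triples (embed ` A)) \<le> real (card W)"
    unfolding collinear_triples_def using finW by (simp add: surj_card_le)
  also have "\<dots> = (\<Sum>b\<in>A. \<Sum>d\<in>D. real (card (G d)) * real (card (T b d)))"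
    unfolding W_def using finA finD finG finT
    by (subst card_SigmaI; (subst card_SigmaI)?) (auto simp: card_cartesian_product)
  also have "\<dots> \<le> (\<Sum>b\<in>A. \<Sum>d\<in>D. 2 * (k / height d) * (8 * (k / height d)))"
  proof (intro sum_mono mult_mono)
    fix b d assume "d \<in> D"
    then show "0 \<le> 2 * (k / height d)" using D by (auto intro!: divide_nonneg_nonneg)
  qed (use finG finT in auto)
  also have "\<dots> = card A * (16 * real k ^ 2 * (\<Sum>d\<in>D. 1 / (real_of_int (height d))\<^sup>2))"
    by (simp add: sum_distrib_left power2_eq_square)
  also have "(\<Sum>d\<in>D. 1 / (real_of_int (height d))\<^sup>2)
      \<le> (\<Sum>d | 1 \<le> height d \<and> height d \<le> int k. 1 / (real_of_int (height d))\<^sup>2)"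
    using D by (intro sum_mono2 sum_inverse_square_height) auto
  also have "\<dots> \<le> 54 * k" by (rule sum_inverse_square_height)
  also have "real (card A) * (16 * real k ^ 2 * real (54 * k)) = 864 * real k ^ 3 * real (card A)"
    by (simp add: power3_eq_cube power2_eq_square)
  finally show ?thesis by (simp add: mult_left_mono)
qed

section \<open>The paraboloid of an anisotropic form modulo a prime\<close>

definition paraboloid :: "int \<Rightarrow> int \<Rightarrow> (int ^ 3) set" where
  "paraboloid p c = {x. p dvd x $ 3 - (x $ 1)\<^sup>2 + c * (x $ 2)\<^sup>2}"

text \<open>
  On a line with direction \<open>d\<close> the equation of the paraboloid is a polynomial of degree at most two
  in the parameter. If it had three roots modulo \<open>p\<close>, its coefficients would vanish: first the
  leading one \<open>Q\<close>, which by anisotropy kills \<open>d $ 1\<close> and \<open>d $ 2\<close>, then the linear one, which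
  leaves \<open>d $ 3 \<equiv> 0\<close> and contradicts primitivity.
\<close>
lemma cap_mod_paraboloid:
  assumes "prime p" and aniso: "\<And>a b. p dvd a\<^sup>2 - c * b\<^sup>2 \<Longrightarrow> p dvd a \<and> p dvd b"
  shows "cap_mod p (paraboloid p c)"
  unfolding cap_mod_def
proof (intro allI impI, rule ccontr)
  fix u d :: "int ^ 3" and x y z :: int
  assume d: "primitive d"
    and xyz: "u + x *s d \<in> paraboloid p c" "u + y *s d \<in> paraboloid p c" "u + z *s d \<in> paraboloid p c"
    and "\<not> (p dvd x - y \<or> p dvd x - z \<or> p dvd y - z)"
  then have nd: "\<not> p dvd x - y" "\<not> p dvd x - z" "\<not> p dvd y - z" by auto
  define f where "f t = (u $ 3 + t * d $ 3) - (u $ 1 + t * d $ 1)\<^sup>2 + c * (u $ 2 + t * d $ 2)\<^sup>2" for t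
  define Q B where "Q = (d $ 1)\<^sup>2 - c * (d $ 2)\<^sup>2"
    and "B = d $ 3 - 2 * u $ 1 * d $ 1 + 2 * c * u $ 2 * d $ 2"
  have f: "p dvd f x" "p dvd f y" "p dvd f z"
    using xyz by (auto simp: paraboloid_def f_def)
  have diff: "f s - f t = (s - t) * (B - Q * (s + t))" for s t
    by (simp add: f_def Q_def B_def power2_eq_square algebra_simps)
  have 1: "p dvd B - Q * (x + y)"
    using dvd_diff[OF f(1,2)] nd(1) \<open>prime p\<close> by (simp add: diff prime_dvd_mult_iff)
  have 2: "p dvd B - Q * (x + z)"
    using dvd_diff[OF f(1,3)] nd(2) \<open>prime p\<close> by (simp add: diff prime_dvd_mult_iff)
  have "p dvd Q * (y - z)"
    using dvd_diff[OF 2 1] by (simp add: algebra_simps)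
  then have Q: "p dvd Q" using nd(3) \<open>prime p\<close> by (simp add: prime_dvd_mult_iff)
  then have ab: "p dvd d $ 1" "p dvd d $ 2" using aniso[OF Q[unfolded Q_def]] by simp_all
  have "p dvd (B - Q * (x + y)) + Q * (x + y)" using 1 Q by (intro dvd_add dvd_mult2)
  then have "p dvd B" by (simp only: diff_add_cancel)
  then have "p dvd B + 2 * u $ 1 * d $ 1 - 2 * c * u $ 2 * d $ 2"
    using ab by (intro dvd_diff dvd_add dvd_mult)
  moreover have "B + 2 * u $ 1 * d $ 1 - 2 * c * u $ 2 * d $ 2 = d $ 3" by (simp add: B_def)
  ultimately have "p dvd d $ 3" by (simp only:)
  then have "p dvd d $ i" for i using ab exhaust_3[of i] by metis
  then have "p dvd 1" using primitive_not_dvd d by blast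
  then show False using \<open>prime p\<close> not_prime_unit by blast
qed

text \<open>
  Any quadratic nonresidue \<open>c\<close> works, since a nontrivial zero \<open>(a, b)\<close> would make \<open>c\<close> the square of
  \<open>a / b\<close>. A nonresidue exists because \<open>1\<close> and \<open>-1\<close> have the same square: squaring is not
  injective, hence not surjective, on the residues.
\<close>
lemma exists_anisotropic:
  fixes p :: int
  assumes "prime p" "p \<noteq> 2"
  shows "\<exists>c. \<forall>a b. p dvd a\<^sup>2 - c * b\<^sup>2 \<longrightarrow> p dvd a \<and> p dvd b"
proof -
  have p: "p > 2" using assms prime_ge_2_int[of p] by simp
  define f where "f x = x\<^sup>2 mod p" for x :: int
  have "(p - 1)\<^sup>2 = 1 + p * (p - 2)" by (simp add: power2_eq_square algebra_simps)
  then have "f 1 = f (p - 1)" by (simp add: f_def)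
  then have "\<not> inj_on f {0..<p}" using p inj_onD[of f "{0..<p}" 1 "p - 1"] by auto
  moreover have "f ` {0..<p} \<subseteq> {0..<p}" using p by (auto simp: f_def)
  ultimately have "f ` {0..<p} \<subset> {0..<p}"
    by (metis eq_card_imp_inj_on finite_atLeastLessThan_int psubsetI)
  then obtain c where c: "c \<in> {0..<p}" "c \<notin> f ` {0..<p}" by blast
  have nonres: "\<not> p dvd x\<^sup>2 - c" for x
  proof
    assume "p dvd x\<^sup>2 - c"
    then have "x\<^sup>2 mod p = c" using c(1) by (metis atLeastLessThan_iff mod_eq_dvd_iff mod_pos_pos_trivial)
    then have "f (x mod p) = c" by (simp add: f_def power_mod)
    then show False using c(2) p by (metis atLeastLessThan_iff image_eqI pos_mod_bound pos_mod_sign order.strict_trans zero_less_numeral)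
  qed
  have "p dvd a \<and> p dvd b" if *: "p dvd a\<^sup>2 - c * b\<^sup>2" for a b
  proof -
    have b: "p dvd b"
    proof (rule ccontr)
      assume "\<not> p dvd b"
      then have "coprime b p" using \<open>prime p\<close> prime_imp_coprime coprime_commute by blast
      then obtain e where "[b * e = 1] (mod p)" using cong_solve_coprime_int by blast
      then have e: "p dvd b * e - 1" by (simp add: cong_iff_dvd_diff)
      have "(a * e)\<^sup>2 - c = e\<^sup>2 * (a\<^sup>2 - c * b\<^sup>2) + (b * e - 1) * (c * (b * e + 1))"
        by (simp add: power2_eq_square algebra_simps)
      then have "p dvd (a * e)\<^sup>2 - c" using * e by simp
      then show False using nonres by blast
    qed
    have "a\<^sup>2 = (a\<^sup>2 - c * b\<^sup>2) + b * (c * b)" by (simp add: power2_eq_square)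
    then have "p dvd a\<^sup>2" using * b by (metis dvd_add dvd_mult2)
    then show ?thesis using b \<open>prime p\<close> prime_dvd_power by blast
  qed
  then show ?thesis by blast
qed

text \<open>
  The interval consists of \<open>k\<close> full periods; \<open>j\<close> numbers them, and the shift by one in the bijection
  accounts for the interval starting at 1.
\<close>
lemma card_congruent_interval:
  fixes p r :: int
  assumes "p \<ge> 1"
  shows "card {z \<in> {1..p * int k}. p dvd z - r} = k"
proof -
  define f where "f j = p * int j + (r - 1) mod p + 1" for j
  have "bij_betw f {..<k} {z \<in> {1..p * int k}. p dvd z - r}"
  proof (rule bij_betw_byWitness[where f' = "\<lambda>z. nat ((z - 1) div p)"])
    have m: "0 \<le> (r - 1) mod p" "(r - 1) mod p < p" using assms by auto
    show "\<forall>j\<in>{..<k}. nat ((f j - 1) div p) = j"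
      using m by (auto simp: f_def div_add1_eq)
    show "\<forall>z\<in>{z \<in> {1..p * int k}. p dvd z - r}. f (nat ((z - 1) div p)) = z"
    proof
      fix z assume z: "z \<in> {z \<in> {1..p * int k}. p dvd z - r}"
      then have "(z - 1) mod p = (r - 1) mod p" by (auto simp: mod_eq_dvd_iff)
      moreover have "(z - 1) div p \<ge> 0" using z assms by (auto simp: pos_imp_zdiv_nonneg_iff)
      ultimately show "f (nat ((z - 1) div p)) = z"
        using mult_div_mod_eq[of p "z - 1"] by (simp add: f_def)
    qed
    show "f ` {..<k} \<subseteq> {z \<in> {1..p * int k}. p dvd z - r}"
    proof clarify
      fix j assume "j < k"
      then have "p * (int j + 1) \<le> p * int k" using assms by (intro mult_left_mono) auto
      then have "f j \<le> p * int k" using m by (simp add: f_def algebra_simps)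
      moreover have "f j \<ge> 1" using m assms by (simp add: f_def)
      moreover have "(f j - 1) mod p = (r - 1) mod p" by (simp add: f_def)
      then have "p dvd f j - r" by (simp add: mod_eq_dvd_iff)
      ultimately show "f j \<in> {1..p * int k} \<and> p dvd f j - r" by simp
    qed
    show "(\<lambda>z. nat ((z - 1) div p)) ` {z \<in> {1..p * int k}. p dvd z - r} \<subseteq> {..<k}"
    proof clarify
      fix z assume z: "z \<in> {1..p * int k}"
      then have "z - 1 < p * int k" by simp
      then have "p * ((z - 1) div p) < p * int k"
        using mult_div_mod_eq[of p "z - 1"] pos_mod_sign[of p "z - 1"] assms by linarith
      then have "(z - 1) div p < int k" using assms by simp
      moreover have "(z - 1) div p \<ge> 0" using z assms by (auto simp: pos_imp_zdiv_nonneg_iff)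
      ultimately show "nat ((z - 1) div p) < k" by linarith
    qed
  qed
  then show ?thesis by (metis bij_betw_same_card card_lessThan)
qed

lemma card_paraboloid_cube:
  fixes p c :: int
  assumes "p \<ge> 1"
  shows "real (card (paraboloid p c \<inter> cube (p * int k))) = (p * int k)\<^sup>2 * k"
proof -
  define n where "n = p * int k"
  define f :: "int \<times> int \<times> int \<Rightarrow> int ^ 3" where "f = (\<lambda>(x, y, z). vector [x, y, z])"
  define Z where "Z r = {z \<in> {1..n}. p dvd z - r}" for r
  have Z: "finite (Z r)" "card (Z r) = k" for r
    unfolding Z_def
    by (rule finite_subset[of _ "{1..n}"]) (auto simp: n_def card_congruent_interval[OF assms, simplified])
  define B where "B = (SIGMA x:{1..n}. SIGMA y:{1..n}. Z (x\<^sup>2 - c * y\<^sup>2))"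
  have "inj f" by (auto simp: inj_def f_def vec_eq_iff forall_3)
  moreover have "f ` B = paraboloid p c \<inter> cube n"
  proof (intro equalityI subsetI)
    fix x assume "x \<in> paraboloid p c \<inter> cube n"
    moreover have "x = f (x $ 1, x $ 2, x $ 3)" by (simp add: f_def vec_eq_iff forall_3)
    ultimately show "x \<in> f ` B"
      by (intro image_eqI[of _ _ "(x $ 1, x $ 2, x $ 3)"])
        (auto simp: B_def Z_def paraboloid_def cube_def algebra_simps)
  qed (auto simp: f_def B_def Z_def paraboloid_def cube_def forall_3 algebra_simps)
  ultimately have "card (paraboloid p c \<inter> cube n) = card B"
    by (metis card_image inj_on_subset subset_UNIV)
  also have "\<dots> = (\<Sum>x\<in>{1..n}. \<Sum>y\<in>{1..n}. k)"
    unfolding B_def by (simp add: Z)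
  also have "\<dots> = nat n * nat n * k" by simp
  finally show ?thesis
    using assms by (simp add: n_def power2_eq_square)
qed

section \<open>Choice of the parameters\<close>

text \<open>
  For \<open>s > 0\<close>, the real number \<open>y = p powr (1 / s - 1)\<close> solves \<open>(p y) powr s = p\<close>. Rounding \<open>y\<close> up
  to an integer at most doubles it, as \<open>y \<ge> 1\<close>, and so changes the power by a factor of at most
  \<open>2 powr s \<le> 2\<close>. This keeps the constant independent of \<open>s\<close>.
\<close>
lemma exists_modulus_near_power:
  assumes "0 \<le> s" "s \<le> 1"
  obtains p k :: nat where "p = 1 \<or> (prime p \<and> p \<noteq> 2)" "k > 0" "N \<le> p * k"
    "real p \<le> real (p * k) powr s" "real (p * k) powr s \<le> 2 * real p"
proof (cases "s = 0")
  case True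
  then show ?thesis by (intro that[of 1 "N + 1"]) auto
next
  case False
  then have s: "s > 0" using assms by simp
  obtain p :: nat where p: "prime p" "p > N + 2" using bigger_prime by blast
  define y where "y = real p powr (1 / s - 1)"
  have y: "y \<ge> 1" unfolding y_def using p s assms by (intro ge_one_powr_ge_zero) auto
  have py: "(real p * y) powr s = real p"
  proof -
    have "real p * y = real p powr (1 / s)"
      using p by (simp add: y_def powr_diff)
    then show ?thesis using s p by (simp add: powr_powr)
  qed
  define k where "k = nat \<lceil>y\<rceil>"
  have k: "y \<le> real k" "real k \<le> 2 * y" using y unfolding k_def by linarith+
  have "k > 0" using k y by (cases k) auto
  have "real p \<le> real (p * k) powr s"
  proof -
    have "(real p * y) powr s \<le> (real p * real k) powr s"
      using k y s by (intro powr_mono2 mult_left_mono) auto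
    then show ?thesis by (simp add: py)
  qed
  moreover have "real (p * k) powr s \<le> 2 * real p"
  proof -
    have "(real p * real k) powr s \<le> (2 * (real p * y)) powr s"
      using mult_left_mono[OF k(2), of "real p"] y s by (intro powr_mono2) auto
    also have "\<dots> = 2 powr s * real p" by (simp only: powr_mult[of 2 "real p * y"] py)
    also have "2 powr s \<le> 2 powr (1::real)" using assms by (intro powr_mono) auto
    finally show ?thesis by (simp add: mult_right_mono)
  qed
  moreover have "N \<le> p * k" using p \<open>k > 0\<close> by (cases k) auto
  ultimately show ?thesis using that[of p k] p \<open>k > 0\<close> by auto
qed

theorem corollary2:
  "\<exists>C::real. C > 0 \<and>
     (\<forall>s::real. 0 \<le> s \<and> s \<le> 1 \<longrightarrow>
       (\<forall>N::nat. \<exists>n\<ge>N. \<exists>S \<subseteq> grid n.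
          real (card S) \<ge> real n powr (3 - s) \<and>
          real (collinear_triples S) \<le> C * real n powr (6 - 4 * s)))"
  \<comment> \<open>The constant is \<open>864 * 2 ^ 4\<close>; the second factor is the loss in \<open>n powr s \<le> 2 * p\<close>.\<close>
proof (intro exI[of _ "13824 :: real"] conjI allI impI)
  fix s :: real and N :: nat
  assume "0 \<le> s \<and> s \<le> 1"
  then obtain p k :: nat where p: "p = 1 \<or> (prime p \<and> p \<noteq> 2)" and k: "k > 0"
    and N: "N \<le> p * k" and lo: "real p \<le> real (p * k) powr s"
    and hi: "real (p * k) powr s \<le> 2 * real p"
    using exists_modulus_near_power by blast
  have p1: "p > 0" "int p \<ge> 1" using p prime_gt_0_nat[of p] by auto
  have "\<exists>c. cap_mod (int p) (paraboloid (int p) c)"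
  proof (cases "p = 1")
    case True
    then show ?thesis by (simp add: cap_mod_def)
  next
    case False
    then have "prime (int p)" "int p \<noteq> 2" using p by auto
    then show ?thesis using exists_anisotropic cap_mod_paraboloid by blast
  qed
  then obtain c where c: "cap_mod (int p) (paraboloid (int p) c)" by blast
  define n where "n = p * k"
  define A where "A = paraboloid (int p) c \<inter> cube (int p * int k)"
  have n: "real n > 0" "real n = real p * real k" using p1 k by (auto simp: n_def)
  have "cap_mod (int p) A" using c unfolding cap_mod_def A_def by blast
  then have triples: "real (collinear_triples (embed ` A)) \<le> 864 * real k ^ 3 * real (card A)"
    using p1 by (intro collinear_triples_cap_mod) (auto simp: A_def)
  have cardA: "real (card A) = real n ^ 2 * real k"
    using card_paraboloid_cube[OF p1(2), of c k] by (simp add: A_def n)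
  have "card (embed ` A) = card A"
    by (metis card_image inj_embed inj_on_subset subset_UNIV)
  moreover have "real n powr (3 - s) \<le> real (card A)"
  proof -
    have "real n powr (3 - s) = real n ^ 3 / real n powr s"
      using n by (simp add: powr_diff)
    also have "\<dots> \<le> real n ^ 3 / real p"
      using lo p1 k by (intro divide_left_mono mult_pos_pos) (auto simp: n_def)
    also have "\<dots> = real (card A)"
      using p1 by (simp add: cardA n power3_eq_cube power2_eq_square)
    finally show ?thesis .
  qed
  moreover have "real (collinear_triples (embed ` A)) \<le> 13824 * real n powr (6 - 4 * s)"
  proof -
    note triples
    also have "864 * real k ^ 3 * real (card A) = 13824 * (real n ^ 6 / (2 * real p) ^ 4)"
      using p1 by (simp add: cardA n field_simps) (simp add: eval_nat_numeral)
    also have "\<dots> \<le> 13824 * (real n ^ 6 / (real n powr s) ^ 4)"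
      using hi k p1
      by (intro mult_left_mono divide_left_mono power_mono mult_pos_pos) (auto simp: n_def)
    also have "(real n powr s) ^ 4 = real n powr (4 * s)"
      using n by (simp add: powr_powr mult.commute flip: powr_numeral)
    also have "real n ^ 6 / real n powr (4 * s) = real n powr (6 - 4 * s)"
      using n by (simp add: powr_diff)
    finally show ?thesis .
  qed
  moreover have "embed ` A \<subseteq> grid n"
    using embed_cube_subset_grid[of n] by (auto simp: A_def n_def)
  moreover have "N \<le> n" using N by (simp add: n_def)
  ultimately show "\<exists>n\<ge>N. \<exists>S \<subseteq> grid n. real (card S) \<ge> real n powr (3 - s) \<and>
      real (collinear_triples S) \<le> 13824 * real n powr (6 - 4 * s)"
    by metis
qed simp

end
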